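(* Let $F(\vec{x},\vec{y})$ be a realizable CNF specification. Then the decision list produced by the Back-and-Forth algorithm on $F$ implements $F$.
   Context: A specification is a Boolean formula $F(\vec{x},\vec{y})$ over input variables $\vec{x}$ and output variables $\vec{y}$; here it is in CNF, $F=\bigwedge_{i=1}^{k} C_i$. $Dom(F)=\{\hat{x}\mid \exists\hat{y}.\,F(\hat{x},\hat{y})=1\}$, where $\hat{x},\hat{y}$ range over assignments to $\vec{x},\vec{y}$. $F$ is realizable if $Dom(F)$ is the set of all assignments to $\vec{x}$. A partial function $g$ from assignments of $\vec{x}$ to assignments of $\vec{y}$ implements $F$ if for every $\hat{x}\in Dom(F)$, $g(\hat{x})$ is defined and $F(\hat{x},g(\hat{x}))=1$. A decision list of length $r$ is a sequence $\langle(f_1,\hat{y}_1),\dots,(f_r,\hat{y}_r)\rangle$ with each $f_i$ a Boolean formula over $\vec{x}$ and each $\hat{y}_i$ an assignment to $\vec{y}$; it denotes the partial function sending $\hat{x}$ to $\hat{y}_i$ for the least $i$ with $f_i(\hat{x})=1$. It implements $F$ if this partial function does. For a clause $C_i$, $C_i|_{\vec{x}}$ (resp. $C_i|_{\vec{y}}$) is the disjunction of all literals of $C_i$ over $\vec{x}$ (resp. $\vec{y}$), the empty disjunction being false. $S_{\vec{x}}=\{C_i|_{\vec{x}}\}$ and $S_{\vec{y}}=\{C_i|_{\vec{y}}\}$ are the sets of input and output clauses. For $S'\subseteq S_{\vec{x}}$, $Co(S')=\{C_i|_{\vec{y}}\mid C_i|_{\vec{x}}\in S'\}$. A set of clauses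 is all-falsifiable if some assignment falsifies every clause in it, and satisfiable if some assignment satisfies every clause in it. An MFS of $S_{\vec{x}}$ is an inclusion-maximal all-falsifiable subset of $S_{\vec{x}}$; an MSS of $S_{\vec{y}}$ is an inclusion-maximal satisfiable subset of $S_{\vec{y}}$. An MSS $M_{\vec{y}}$ of $S_{\vec{y}}$ covers an MFS $M_{\vec{x}}$ of $S_{\vec{x}}$ if $Co(M_{\vec{x}})\subseteq M_{\vec{y}}$. Back-and-Forth algorithm (choices are arbitrary): start with the empty list $L$ of MSSs. While there is an MFS of $S_{\vec{x}}$ not covered by any MSS in $L$: choose such an MFS $M_{\vec{x}}$; if there is an MSS of $S_{\vec{y}}$ covering $M_{\vec{x}}$, choose one and append it to $L$; otherwise fail, reporting that $F$ is unrealizable. When the loop ends with $L=(M^1,\dots,M^r)$, output the decision list $\langle(f_1,\hat{y}_1),\dots,(f_r,\hat{y}_r)\rangle$, where $f_i$ is the conjunction of all $C_j|_{\vec{x}}$ over those clauses $C_j$ of $F$ with $C_j|_{\vec{y}}\notin M^i$, and $\hat{y}_i$ is an arbitrary assignment satisfying $M^i$. *)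

theory Defs
  imports Main "HOL-Library.FSet"
begin

type_synonym 'v assignment = "'v \<Rightarrow> bool"

datatype 'v bform =
    BVar 'v
  | BNot "'v bform"
  | BConj "'v bform fset"
  | BDisj "'v bform fset"

primrec holds :: "'v assignment \<Rightarrow> 'v bform \<Rightarrow> bool" where
  "holds a (BVar v) = a v"
| "holds a (BNot \<phi>) = (\<not> holds a \<phi>)"
| "holds a (BConj \<Phi>) = fBall (holds a |`| \<Phi>) (\<lambda>b. b)"
| "holds a (BDisj \<Phi>) = fBex (holds a |`| \<Phi>) (\<lambda>b. b)"

text \<open>A specification over inputs \<open>'x\<close> and outputs \<open>'y\<close> is a formula whose variables are tagged
  \<open>Inl\<close> (input) or \<open>Inr\<close> (output); \<open>case_sum x y\<close> is the joint assignment. The types are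
  arbitrary, so variables that do not occur in the formula are permitted.\<close>

definition Dom :: "('x + 'y) bform \<Rightarrow> 'x assignment set" where
  "Dom F = {x. \<exists>y. holds (case_sum x y) F}"

definition realizable :: "('x + 'y) bform \<Rightarrow> bool" where
  "realizable F \<longleftrightarrow> Dom F = UNIV"

definition implements :: "('x assignment \<rightharpoonup> 'y assignment) \<Rightarrow> ('x + 'y) bform \<Rightarrow> bool" where
  "implements g F \<longleftrightarrow> (\<forall>x\<in>Dom F. \<exists>y. g x = Some y \<and> holds (case_sum x y) F)"

type_synonym ('x, 'y) decision_list = "('x bform \<times> 'y assignment) list"

definition dl_fun :: "('x, 'y) decision_list \<Rightarrow> 'x assignment \<rightharpoonup> 'y assignment" where
  "dl_fun D x = map_option snd (List.find (\<lambda>(f, y). holds x f) D)"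

datatype 'v literal = Pos (atom: 'v) | Neg (atom: 'v)

type_synonym 'v clause = "'v literal fset"
type_synonym 'v cnf = "'v clause list"

primrec literal_form :: "'v literal \<Rightarrow> 'v bform" where
  "literal_form (Pos v) = BVar v"
| "literal_form (Neg v) = BNot (BVar v)"

definition clause_form :: "'v clause \<Rightarrow> 'v bform" where
  "clause_form C = BDisj (literal_form |`| C)"

definition cnf_form :: "'v cnf \<Rightarrow> 'v bform" where
  "cnf_form F = BConj (fset_of_list (map clause_form F))"

definition restr_x :: "('x + 'y) clause \<Rightarrow> 'x clause" where
  "restr_x C = map_literal projl |`| ffilter (\<lambda>l. isl (atom l)) C"

definition restr_y :: "('x + 'y) clause \<Rightarrow> 'y clause" where
  "restr_y C = map_literal projr |`| ffilter (\<lambda>l. \<not> isl (atom l)) C"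

definition S_x :: "('x + 'y) cnf \<Rightarrow> 'x clause set" where
  "S_x F = restr_x ` set F"

definition S_y :: "('x + 'y) cnf \<Rightarrow> 'y clause set" where
  "S_y F = restr_y ` set F"

definition Co :: "('x + 'y) cnf \<Rightarrow> 'x clause set \<Rightarrow> 'y clause set" where
  "Co F S' = {restr_y C | C. C \<in> set F \<and> restr_x C \<in> S'}"

definition satisfies_all :: "'v assignment \<Rightarrow> 'v clause set \<Rightarrow> bool" where
  "satisfies_all a S \<longleftrightarrow> (\<forall>C\<in>S. holds a (clause_form C))"

definition satisfiable :: "'v clause set \<Rightarrow> bool" where
  "satisfiable S \<longleftrightarrow> (\<exists>a. satisfies_all a S)"

definition all_falsifiable :: "'v clause set \<Rightarrow> bool" where
  "all_falsifiable S \<longleftrightarrow> (\<exists>a. \<forall>C\<in>S. \<not> holds a (clause_form C))"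

definition is_MFS :: "'v clause set \<Rightarrow> 'v clause set \<Rightarrow> bool" where
  "is_MFS S M \<longleftrightarrow> M \<subseteq> S \<and> all_falsifiable M \<and>
     (\<forall>M'. M \<subset> M' \<and> M' \<subseteq> S \<longrightarrow> \<not> all_falsifiable M')"

definition is_MSS :: "'v clause set \<Rightarrow> 'v clause set \<Rightarrow> bool" where
  "is_MSS S M \<longleftrightarrow> M \<subseteq> S \<and> satisfiable M \<and>
     (\<forall>M'. M \<subset> M' \<and> M' \<subseteq> S \<longrightarrow> \<not> satisfiable M')"

definition covers :: "('x + 'y) cnf \<Rightarrow> 'y clause set \<Rightarrow> 'x clause set \<Rightarrow> bool" where
  "covers F My Mx \<longleftrightarrow> Co F Mx \<subseteq> My"

definition uncovered_MFS :: "('x + 'y) cnf \<Rightarrow> 'y clause set list \<Rightarrow> 'x clause set \<Rightarrow> bool" where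
  "uncovered_MFS F L Mx \<longleftrightarrow> is_MFS (S_x F) Mx \<and> (\<forall>My\<in>set L. \<not> covers F My Mx)"

definition guard :: "('x + 'y) cnf \<Rightarrow> 'y clause set \<Rightarrow> 'x bform" where
  "guard F M = cnf_form (map restr_x (filter (\<lambda>C. restr_y C \<notin> M) F))"

text \<open>The nondeterminism of the algorithm is rendered by a transition relation: a run may take any
  transition, and an implementation fixes the choices.\<close>

datatype ('x, 'y) bf_state =
    Running "'y clause set list"
  | Failed
  | Output "('x, 'y) decision_list"

inductive bf_step :: "('x + 'y) cnf \<Rightarrow> ('x, 'y) bf_state \<Rightarrow> ('x, 'y) bf_state \<Rightarrow> bool"
  for F :: "('x + 'y) cnf" where
  extend: "\<lbrakk>uncovered_MFS F L Mx; is_MSS (S_y F) My; covers F My Mx\<rbrakk>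
     \<Longrightarrow> bf_step F (Running L) (Running (L @ [My]))"
| fail: "\<lbrakk>uncovered_MFS F L Mx; \<nexists>My. is_MSS (S_y F) My \<and> covers F My Mx\<rbrakk>
     \<Longrightarrow> bf_step F (Running L) Failed"
| finish: "\<lbrakk>\<nexists>Mx. uncovered_MFS F L Mx;
      list_all2 (\<lambda>M (f, y). f = guard F M \<and> satisfies_all y M) L D\<rbrakk>
     \<Longrightarrow> bf_step F (Running L) (Output D)"

definition bf_diverges :: "('x + 'y) cnf \<Rightarrow> bool" where
  "bf_diverges F \<longleftrightarrow>
     (\<exists>\<sigma>. \<sigma> 0 = Running [] \<and> (\<forall>n::nat. bf_step F (\<sigma> n) (\<sigma> (Suc n))))"

definition bf_halts_in :: "('x + 'y) cnf \<Rightarrow> ('x, 'y) bf_state \<Rightarrow> bool" where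
  "bf_halts_in F s \<longleftrightarrow> (bf_step F)\<^sup>*\<^sup>* (Running []) s \<and> (\<nexists>t. bf_step F s t)"

end

theory Submission
  imports Defs
begin

text \<open>Every appended MSS covers a previously uncovered MFS, and there are finitely many MFSs, so
  the algorithm terminates. An assignment \<open>x\<close> falsifying an MFS \<open>Mx\<close> leaves the clauses of
  \<open>Co F Mx\<close> to be satisfied by the outputs alone; realizability at \<open>x\<close> thus makes \<open>Co F Mx\<close>
  satisfiable, and it extends to an MSS, so the algorithm never fails. On termination, the input
  clauses falsified by a given \<open>x\<close> lie in an MFS, which is covered by some MSS of the list; the
  guard of that MSS holds at \<open>x\<close>. Conversely, whenever the guard of an MSS \<open>M\<close> holds at \<open>x\<close>, any
  output satisfying \<open>M\<close> completes \<open>x\<close> to a model of the specification.\<close>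

lemma holds_cnf_form: "holds a (cnf_form F) \<longleftrightarrow> (\<forall>C\<in>set F. holds a (clause_form C))"
  by (auto simp: cnf_form_def fset_of_list_elem)

lemma holds_clause_form: "holds a (clause_form C) \<longleftrightarrow> (\<exists>l. l |\<in>| C \<and> holds a (literal_form l))"
  by (auto simp: clause_form_def)

lemma holds_map_projl:
  "isl (atom l) \<Longrightarrow> holds x (literal_form (map_literal projl l)) = holds (case_sum x y) (literal_form l)"
  by (cases l) (auto simp: isl_def)

lemma holds_map_projr:
  "\<not> isl (atom l) \<Longrightarrow> holds y (literal_form (map_literal projr l)) = holds (case_sum x y) (literal_form l)"
  by (cases l; cases "atom l") auto

text \<open>The free \<open>y\<close> is harmless: a literal over an input variable ignores it. With
  the joint assignment on the right, both restrictions refer to the same literals and can be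
  recombined.\<close>

lemma holds_restr_x:
  "holds x (clause_form (restr_x C)) \<longleftrightarrow>
    (\<exists>l. l |\<in>| C \<and> isl (atom l) \<and> holds (case_sum x y) (literal_form l))"
  by (auto simp: holds_clause_form restr_x_def holds_map_projl[of _ x y])

lemma holds_restr_y:
  "holds y (clause_form (restr_y C)) \<longleftrightarrow>
    (\<exists>l. l |\<in>| C \<and> \<not> isl (atom l) \<and> holds (case_sum x y) (literal_form l))"
  by (auto simp: holds_clause_form restr_y_def holds_map_projr[of _ y x])

lemma holds_clause_case_sum:
  "holds (case_sum x y) (clause_form C) \<longleftrightarrow>
    holds x (clause_form (restr_x C)) \<or> holds y (clause_form (restr_y C))"
  unfolding holds_restr_x[of x C y] holds_restr_y[of y C x] holds_clause_form[of _ C] by blast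

lemma holds_guard:
  "holds x (guard F M) \<longleftrightarrow> (\<forall>C\<in>set F. restr_y C \<notin> M \<longrightarrow> holds x (clause_form (restr_x C)))"
  by (auto simp: guard_def holds_cnf_form)

lemma guard_sound:
  assumes "holds x (guard F M)" and "satisfies_all y M"
  shows "holds (case_sum x y) (cnf_form F)"
  using assms by (auto simp: holds_cnf_form holds_clause_case_sum holds_guard satisfies_all_def)

text \<open>Kept generic in \<open>P\<close> so that it serves MFSs and MSSs alike; finiteness of
  \<open>S\<close> leaves only finitely many candidates.\<close>

lemma maximal_superset_exists:
  assumes "finite S" and "A \<subseteq> S" and "P A"
  shows "\<exists>M. A \<subseteq> M \<and> M \<subseteq> S \<and> P M \<and> (\<forall>M'. M \<subset> M' \<and> M' \<subseteq> S \<longrightarrow> \<not> P M')"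
proof -
  have "finite {M. M \<subseteq> S \<and> P M}"
    using \<open>finite S\<close> by simp
  then obtain M where "M \<subseteq> S" "P M" "A \<subseteq> M"
    and max: "\<forall>M'\<in>{M. M \<subseteq> S \<and> P M}. M \<subseteq> M' \<longrightarrow> M = M'"
    using finite_has_maximal2[of "{M. M \<subseteq> S \<and> P M}" A] assms(2,3) by auto
  moreover have "\<forall>M'. M \<subset> M' \<and> M' \<subseteq> S \<longrightarrow> \<not> P M'"
    using max by auto
  ultimately show ?thesis
    by metis
qed

lemma MFS_superset_exists:
  "finite S \<Longrightarrow> A \<subseteq> S \<Longrightarrow> all_falsifiable A \<Longrightarrow> \<exists>M. A \<subseteq> M \<and> is_MFS S M"
  unfolding is_MFS_def by (rule maximal_superset_exists)

lemma MSS_superset_exists: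
  "finite S \<Longrightarrow> A \<subseteq> S \<Longrightarrow> satisfiable A \<Longrightarrow> \<exists>M. A \<subseteq> M \<and> is_MSS S M"
  unfolding is_MSS_def by (rule maximal_superset_exists)

lemma finite_S_x: "finite (S_x F)"
  by (simp add: S_x_def)

lemma finite_S_y: "finite (S_y F)"
  by (simp add: S_y_def)

lemma finite_uncovered_MFS: "finite {Mx. uncovered_MFS F L Mx}"
  by (rule finite_subset[of _ "Pow (S_x F)"])
    (auto simp: finite_S_x uncovered_MFS_def is_MFS_def)

lemma uncovered_MFS_snoc:
  "uncovered_MFS F (L @ [My]) Mx \<longleftrightarrow> uncovered_MFS F L Mx \<and> \<not> covers F My Mx"
  by (auto simp: uncovered_MFS_def)

text \<open>Appending never uncovers an MFS, and \<open>Mx\<close> itself drops out, so the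
  inclusion is strict.\<close>

lemma card_uncovered_MFS_snoc:
  assumes "uncovered_MFS F L Mx" and "covers F My Mx"
  shows "card {Mx. uncovered_MFS F (L @ [My]) Mx} < card {Mx. uncovered_MFS F L Mx}"
  using assms by (intro psubset_card_mono finite_uncovered_MFS) (auto simp: uncovered_MFS_snoc)

lemma not_bf_diverges: "\<not> bf_diverges F"
proof
  assume "bf_diverges F"
  then obtain \<sigma> where step: "\<And>n::nat. bf_step F (\<sigma> n) (\<sigma> (Suc n))"
    by (auto simp: bf_diverges_def)
  \<comment> \<open>Every state of an infinite run has a successor, which \<open>Failed\<close> and
    \<open>Output\<close> lack.\<close>
  have running: "\<exists>L. \<sigma> n = Running L" for n
    using step[of n] by cases auto
  then obtain L where L: "\<And>n. \<sigma> n = Running (L n)"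
    by metis
  let ?m = "\<lambda>n. card {Mx. uncovered_MFS F (L n) Mx}"
  have "?m (Suc n) < ?m n" for n
    using step[of n] unfolding L by cases (auto intro: card_uncovered_MFS_snoc)
  then show False
    using wf_no_infinite_down_chainE[OF wf_less, of ?m] by blast
qed

lemma covering_MSS_exists:
  assumes "realizable (cnf_form F)" and "is_MFS (S_x F) Mx"
  shows "\<exists>My. is_MSS (S_y F) My \<and> covers F My Mx"
proof -
  obtain x where x: "\<forall>C\<in>Mx. \<not> holds x (clause_form C)"
    using assms(2) by (auto simp: is_MFS_def all_falsifiable_def)
  obtain y where "holds (case_sum x y) (cnf_form F)"
    using assms(1) by (auto simp: realizable_def Dom_def)
  with x have "satisfies_all y (Co F Mx)"
    by (auto simp: satisfies_all_def Co_def holds_cnf_form holds_clause_case_sum)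
  then have "satisfiable (Co F Mx)"
    by (auto simp: satisfiable_def)
  moreover have "Co F Mx \<subseteq> S_y F"
    by (auto simp: Co_def S_y_def)
  ultimately show ?thesis
    using MSS_superset_exists[OF finite_S_y] unfolding covers_def by blast
qed

lemma guard_complete:
  assumes "\<nexists>Mx. uncovered_MFS F L Mx"
  shows "\<exists>M\<in>set L. holds x (guard F M)"
proof -
  \<comment> \<open>\<open>x\<close> itself witnesses that \<open>?A\<close> is
    all-falsifiable.\<close>
  let ?A = "{C \<in> S_x F. \<not> holds x (clause_form C)}"
  have "all_falsifiable ?A"
    by (auto simp: all_falsifiable_def)
  then obtain Mx where Mx: "?A \<subseteq> Mx" "is_MFS (S_x F) Mx"
    using MFS_superset_exists[OF finite_S_x, of ?A F] by auto
  then obtain M where "M \<in> set L" and "Co F Mx \<subseteq> M"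
    using assms by (auto simp: uncovered_MFS_def covers_def)
  moreover have "holds x (clause_form (restr_x C))" if "C \<in> set F" "restr_y C \<notin> M" for C
  proof (rule ccontr)
    assume "\<not> holds x (clause_form (restr_x C))"
    then have "restr_x C \<in> Mx"
      using that(1) Mx(1) by (auto simp: S_x_def)
    then show False
      using that \<open>Co F Mx \<subseteq> M\<close> by (auto simp: Co_def)
  qed
  ultimately show ?thesis
    by (auto simp: holds_guard)
qed

lemma finish_implements:
  assumes "\<nexists>Mx. uncovered_MFS F L Mx"
    and D: "list_all2 (\<lambda>M (f, y). f = guard F M \<and> satisfies_all y M) L D"
  shows "implements (dl_fun D) (cnf_form F)"
  unfolding implements_def
proof
  \<comment> \<open>This turns \<open>list_all2\<close> into \<open>rel_set\<close> between
    \<open>set L\<close> and \<open>set D\<close>, so that entries can be matched in both directions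
    without indices.\<close>
  note rel = rel_funD[OF list.set_transfer D]
  fix x
  obtain M where "M \<in> set L" and "holds x (guard F M)"
    using guard_complete[OF assms(1)] by blast
  then have "\<exists>(f, y)\<in>set D. holds x f"
    using rel_setD1[OF rel] by fast
  then have "List.find (\<lambda>(f, y). holds x f) D \<noteq> None"
    by (auto simp: find_None_iff)
  then obtain f y where find: "List.find (\<lambda>(f, y). holds x f) D = Some (f, y)"
    by auto
  then have "(f, y) \<in> set D" and "holds x f"
    by (auto simp: find_Some_iff in_set_conv_nth)
  \<comment> \<open>The first entry that fires may belong to an MSS \<open>M'\<close> other than
    \<open>M\<close>; this does no harm, as \<open>guard_sound\<close> applies to any entry whose
    guard holds.\<close>
  then obtain M' where "f = guard F M'" and "satisfies_all y M'"
    using rel_setD2[OF rel] by fast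
  then have "holds (case_sum x y) (cnf_form F)"
    using \<open>holds x f\<close> guard_sound by blast
  then show "\<exists>y. dl_fun D x = Some y \<and> holds (case_sum x y) (cnf_form F)"
    using find by (simp add: dl_fun_def)
qed

lemma satisfying_outputs_exist:
  assumes "\<forall>M\<in>set L. satisfiable M"
  shows "\<exists>D. list_all2 (\<lambda>M (f, y). f = guard F M \<and> satisfies_all y M) L D"
proof -
  obtain g where "\<forall>M\<in>set L. satisfies_all (g M) M"
    using assms unfolding satisfiable_def by metis
  then have "list_all2 (\<lambda>M (f, y). f = guard F M \<and> satisfies_all y M) L
      (map (\<lambda>M. (guard F M, g M)) L)"
    by (simp add: list_all2_conv_all_nth)
  then show ?thesis ..
qed

text \<open>An invariant of runs. Its \<open>Running\<close> case records satisfiability because the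
  final choice of outputs depends on it.\<close>

lemma bf_reachable:
  assumes "realizable (cnf_form F)" and "(bf_step F)\<^sup>*\<^sup>* (Running []) s"
  shows "case s of Running L \<Rightarrow> \<forall>M\<in>set L. satisfiable M
    | Failed \<Rightarrow> False
    | Output D \<Rightarrow> implements (dl_fun D) (cnf_form F)"
  using assms(2)
proof (induction rule: rtranclp_induct)
  case base
  then show ?case by simp
next
  case (step s t)
  from step.hyps(2) show ?case
  proof cases
    case (extend L Mx My)
    then show ?thesis
      using step.IH by (auto simp: is_MSS_def)
  next
    case (fail L Mx)
    then show ?thesis
      using covering_MSS_exists[OF assms(1)] by (auto simp: uncovered_MFS_def)
  next
    case (finish L D)
    then show ?thesis
      using finish_implements by auto
  qed
qed

text \<open>Progress: a run cannot get stuck inside the loop. If an MFS is uncovered, either a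
  covering MSS exists or failure is reported; otherwise outputs can be chosen for all of
  \<open>L\<close>.\<close>

lemma bf_step_Running:
  assumes "\<forall>M\<in>set L. satisfiable M"
  shows "\<exists>t. bf_step F (Running L) t"
proof (cases "\<exists>Mx. uncovered_MFS F L Mx")
  case True
  then show ?thesis
    by (blast intro: bf_step.extend bf_step.fail)
next
  case False
  then show ?thesis
    using satisfying_outputs_exist[OF assms, of F] by (blast intro: bf_step.finish)
qed

theorem corollary3:
  fixes F :: "('x + 'y) cnf"
  assumes "realizable (cnf_form F)"
  shows "\<not> bf_diverges F \<and>
    (\<forall>s. bf_halts_in F s \<longrightarrow> (\<exists>D. s = Output D \<and> implements (dl_fun D) (cnf_form F)))"
proof (intro conjI allI impI)
  show "\<not> bf_diverges F"
    by (rule not_bf_diverges)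
next
  fix s
  assume "bf_halts_in F s"
  then have "(bf_step F)\<^sup>*\<^sup>* (Running []) s" and halt: "\<nexists>t. bf_step F s t"
    by (auto simp: bf_halts_in_def)
  from bf_reachable[OF assms this(1)]
  show "\<exists>D. s = Output D \<and> implements (dl_fun D) (cnf_form F)"
    \<comment> \<open>Progress rules out \<open>Running\<close>, the invariant rules out
      \<open>Failed\<close>.\<close>
    using halt by (cases s) (auto dest: bf_step_Running[where F = F])
qed

end
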